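(* Let $\mathbb{F}$ be a field and $n$ a positive integer, and suppose that the characteristic of $\mathbb{F}$ is either zero or larger than $n$. Let $A \in M_n(\mathbb{F})$ be a non-zero matrix of rank $m$. Then the following assertions are equivalent: (a) $A^r = A^{(r)}$ for every positive integer $r$; (b) $A^r = A^{(r)}$ for every integer $r \in \{2, 3, \ldots, n+1\}$; (c) There exist a positive integer $k$, distinct non-zero elements $\lambda_1, \ldots, \lambda_k \in \mathbb{F}$, and idempotent $(0,1)$-matrices $E_1, \ldots, E_k \in M_n(\mathbb{F})$ such that $A = \sum_{i=1}^k \lambda_i E_i$ and $E_i \circ E_j = E_i E_j = 0$ for all $i \neq j$; (d) There exist an $n \times n$ permutation matrix $P$, non-zero elements $\mu_1, \ldots, \mu_m \in \mathbb{F}$ (not necessarily distinct), integers $a, b, c \ge 0$ with $m + a + b + c = n$, an $m \times a$ $(0,1)$-matrix $U$ and a $b \times m$ $(0,1)$-matrix $V$ over $\mathbb{F}$ such that $U$ has no zero columns, $V$ has no zero rows, $VU$ is also a $(0,1)$-matrix, and $$P A P^{\mathrm{T}} = \sum_{i=1}^m \mu_i v_i u_i^{\mathrm{T}},$$ where $u_1^{\mathrm{T}}, \ldots, u_m^{\mathrm{T}}$ are the rows of the $m \times n$ matrix $\begin{bmatrix} I & U & 0 & 0 \end{bmatrix}$ (column blocks of sizes $m, a, b, c$), and $v_1, \ldots, v_m$ are the columns of the $n \times m$ matrix $\begin{bmatrix} I \\ 0 \\ V \\ 0 \end{bmatrix}$ (row blocks of sizes $m, a, b, c$), with $I$ the identity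 matrix of size $m$.
   Context: $M_n(\mathbb{F})$ is the algebra of all $n \times n$ matrices over the field $\mathbb{F}$. For $A = [a_{ij}]_{i,j=1}^n$ and $B = [b_{ij}]_{i,j=1}^n$ in $M_n(\mathbb{F})$, the Hadamard product is $A \circ B = [a_{ij} b_{ij}]_{i,j=1}^n$, and $AB$ denotes the usual matrix product. For a positive integer $r$, $A^{(r)} = [a_{ij}^r]_{i,j=1}^n$ is the $r$-th Hadamard power of $A$, and $A^r$ is the usual $r$-th matrix power. A $(0,1)$-matrix is a matrix each of whose entries is $0$ or $1$ (as elements of $\mathbb{F}$). A matrix $E$ is idempotent if $E^2 = E$ (usual product). Any of the blocks of sizes $a, b, c$ may be empty (size $0$). The product $VU$ is computed over $\mathbb{F}$. *)

theory Defs
  imports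
    "Jordan_Normal_Form.DL_Rank"
    "HOL-Combinatorics.Permutations"
begin

definition hadamard_prod :: "'a :: times mat \<Rightarrow> 'a mat \<Rightarrow> 'a mat" (infixl \<open>\<circ>\<^sub>H\<close> 70) where
  "A \<circ>\<^sub>H B = mat (dim_row A) (dim_col A) (\<lambda>ij. A $$ ij * B $$ ij)"

definition hadamard_pow :: "'a :: monoid_mult mat \<Rightarrow> nat \<Rightarrow> 'a mat" where
  "hadamard_pow A r = map_mat (\<lambda>x. x ^ r) A"

definition zero_one_mat :: "'a :: zero_neq_one mat \<Rightarrow> bool" where
  "zero_one_mat A \<longleftrightarrow> elements_mat A \<subseteq> {0, 1}"

definition idempotent_mat :: "'a :: semiring_0 mat \<Rightarrow> bool" where
  "idempotent_mat E \<longleftrightarrow> E * E = E"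

definition permutation_matrix :: "nat \<Rightarrow> 'a :: zero_neq_one mat \<Rightarrow> bool" where
  "permutation_matrix n P \<longleftrightarrow>
     (\<exists>p. p permutes {..<n} \<and> P = mat n n (\<lambda>(i, j). if j = p i then 1 else 0))"

text \<open>The column vector \<open>v\<close> times the row vector \<open>w\<close>, as a matrix product.\<close>

definition outer_prod :: "'a :: semiring_0 vec \<Rightarrow> 'a vec \<Rightarrow> 'a mat" where
  "outer_prod v w = transpose_mat (mat_of_row v) * mat_of_row w"

text \<open>Horizontal counterpart of \<^const>\<open>append_rows\<close>; the lower two blocks have no rows.\<close>

definition append_cols :: "'a :: zero mat \<Rightarrow> 'a mat \<Rightarrow> 'a mat" (infixr \<open>@\<^sub>c\<close> 65) where
  "A @\<^sub>c B = four_block_mat A B (0\<^sub>m 0 (dim_col A)) (0\<^sub>m 0 (dim_col B))"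

text \<open>The block matrix \<open>[I U 0 0]\<close> and the block column with blocks \<open>I\<close>, \<open>0\<close>, \<open>V\<close>, \<open>0\<close>.
  Both use the same block sizes \<open>m\<close>, \<open>a\<close>, \<open>b\<close>, \<open>c\<close>, any of which may be \<open>0\<close>.\<close>

definition row_blocks :: "nat \<Rightarrow> nat \<Rightarrow> nat \<Rightarrow> 'a :: {zero, one} mat \<Rightarrow> 'a mat" where
  "row_blocks m b c U = 1\<^sub>m m @\<^sub>c U @\<^sub>c 0\<^sub>m m b @\<^sub>c 0\<^sub>m m c"

definition col_blocks :: "nat \<Rightarrow> nat \<Rightarrow> nat \<Rightarrow> 'a :: {zero, one} mat \<Rightarrow> 'a mat" where
  "col_blocks m a c V = 1\<^sub>m m @\<^sub>r 0\<^sub>m a m @\<^sub>r V @\<^sub>r 0\<^sub>m c m"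

text \<open>Finite sums of \<open>n \<times> n\<close> matrices; the matrix type itself is not an additive monoid.\<close>

abbreviation msum :: "nat \<Rightarrow> ('i \<Rightarrow> 'a :: semiring_1 mat) \<Rightarrow> 'i set \<Rightarrow> 'a mat" where
  "msum n f I \<equiv> finsum (module_mat TYPE('a) n n) f I"

end

theory Submission
  imports Defs "HOL-Number_Theory.Cong"
begin

text \<open>
  Entrywise, \<open>A\<^sup>r\<close> and the Hadamard power agree for \<open>2 \<le> r \<le> n + 1\<close> iff
  \<open>\<Sum>\<^sub>t a\<^sub>p\<^sub>t\<^sup>r a\<^sub>t\<^sub>q = a\<^sub>p\<^sub>q\<^bsup>r+1\<^esup>\<close> for \<open>1 \<le> r \<le> n\<close>. A single row or column
  has at most \<open>n\<close> distinct values, so a Vandermonde argument separates them. Doing this first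
  along rows and then along columns shows that the indicator matrices \<open>E\<^sub>\<mu>\<close> of the non-zero
  values satisfy \<open>E\<^sub>\<mu> E\<^sub>\<nu> = \<delta>\<^sub>\<mu>\<^sub>\<nu> E\<^sub>\<nu>\<close>, although \<open>A\<close> might a priori have up to \<open>n\<^sup>2\<close> values.

  As the characteristic is 0 or exceeds \<open>n\<close>, these are identities between cardinalities. They say that in
  the digraph \<open>p \<rightarrow> q \<longleftrightarrow> A\<^sub>p\<^sub>q \<noteq> 0\<close> a pair has a midpoint iff it is an edge, that
  the midpoint is unique, and
  that \<open>A\<close> has the same value on the three edges. Every midpoint then carries a loop, and there are
  no edges between different loops; a vertex without a loop is a sink, a source or isolated. Listing
  loops, sinks, sources and isolated vertices in this order produces the block form, whose \<open>m\<close> is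
  the number of loops, which is the rank.

  Conversely, both decompositions write \<open>A\<close> as a combination of pairwise orthogonal and disjointly
  supported (0,1)-idempotents, and for such a combination either kind of power raises the coefficients.
\<close>

section \<open>Separation of values by power sums\<close>

text \<open>Vandermonde elimination by induction on \<open>S\<close>: subtracting \<open>y\<close>
  times the equation for \<open>r\<close> from the one for \<open>r + 1\<close> removes
  \<open>y\<close> and multiplies every other coefficient by the non-zero factor
  \<open>x - y\<close>. The exponents start at 1, hence \<open>0\<close> is excluded.\<close>

lemma power_sums_eq_0_imp:
  fixes c :: "'a :: field \<Rightarrow> 'a"
  assumes "finite S" "0 \<notin> S" "\<And>r. r \<in> {1..card S} \<Longrightarrow> (\<Sum>x\<in>S. c x * x ^ r) = 0" "x \<in> S"
  shows "c x = 0"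
  using assms
proof (induction S arbitrary: c x rule: finite_induct)
  case empty
  then show ?case by simp
next
  case (insert y S)
  have *: "c x * (x - y) = 0" if "x \<in> S" for x
  proof (rule insert.IH[where c = "\<lambda>x. c x * (x - y)"])
    fix r assume r: "r \<in> {1..card S}"
    have "(\<Sum>x\<in>insert y S. c x * x ^ Suc r) = 0" "(\<Sum>x\<in>insert y S. c x * x ^ r) = 0"
      by (rule insert.prems(2); use r insert.hyps in simp)+
    hence "(\<Sum>x\<in>insert y S. c x * x ^ Suc r) - y * (\<Sum>x\<in>insert y S. c x * x ^ r) = 0"
      by simp
    thus "(\<Sum>x\<in>S. c x * (x - y) * x ^ r) = 0"
      using insert.hyps by (simp add: algebra_simps sum_distrib_left sum_subtractf)
  qed (use insert.prems that in auto)
  hence c0: "c x = 0" if "x \<in> S" for x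
    using that insert.hyps by force
  \<comment> \<open>With the other coefficients gone, the equation for exponent 1 leaves only
    \<open>c y * y\<close>, and \<open>y\<close> is non-zero.\<close>
  have "(\<Sum>x\<in>insert y S. c x * x ^ 1) = 0"
    by (rule insert.prems(2)) (use insert.hyps in auto)
  hence "c y * y = 0"
    using insert.hyps c0 by simp
  thus ?case
    using insert.prems c0 by auto
qed

text \<open>Terms with the same value of \<open>g\<close> are grouped, so that separation applies to
  distinct values. There are at most \<open>n\<close> of them, so exponents up to \<open>n\<close>
  suffice; the value 0 drops out because the exponents are positive.\<close>

lemma power_sums_eq_0_imp_fibre_sum_eq_0:
  fixes b g :: "nat \<Rightarrow> 'a :: field"
  assumes "\<And>r. r \<in> {1..n} \<Longrightarrow> (\<Sum>t<n. b t * g t ^ r) = 0" "\<nu> \<noteq> 0"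
  shows "(\<Sum>t<n. if g t = \<nu> then b t else 0) = 0"
proof (cases "\<nu> \<in> g ` {..<n}")
  case True
  define c where "c x = (\<Sum>t<n. if g t = x then b t else 0)" for x
  let ?S = "g ` {..<n} - {0}"
  have "card ?S \<le> card (g ` {..<n})"
    by (intro card_mono) auto
  also have "\<dots> \<le> n"
    using card_image_le[of "{..<n}" g] by simp
  finally have card: "card ?S \<le> n" .
  have "c \<nu> = 0"
  proof (rule power_sums_eq_0_imp[where S = ?S and c = c])
    fix r assume r: "r \<in> {1..card ?S}"
    have "(\<Sum>x\<in>?S. c x * x ^ r) = (\<Sum>t<n. \<Sum>x\<in>?S. (if g t = x then b t else 0) * x ^ r)"
      unfolding c_def sum_distrib_right by (rule sum.swap)
    also have "\<dots> = (\<Sum>t<n. \<Sum>x\<in>?S. if x = g t then b t * g t ^ r else 0)"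
      by (intro sum.cong) auto
    also have "\<dots> = (\<Sum>t<n. b t * g t ^ r)"
      using r by (intro sum.cong) auto
    also have "\<dots> = 0"
      using r card by (intro assms(1)) auto
    finally show "(\<Sum>x\<in>?S. c x * x ^ r) = 0" .
  qed (use True assms(2) in auto)
  thus ?thesis
    by (simp add: c_def)
next
  case False
  thus ?thesis by (intro sum.neutral) auto
qed

section \<open>From power equations to orthogonal level matrices\<close>

text \<open>The entrywise form of \<open>hadamard_pow A r * A = hadamard_pow A (Suc r)\<close>. The
  bound \<open>N\<close> is kept apart from the size \<open>n\<close>: condition (b) is the case
  \<open>N = n\<close>, while condition (a) asks for every \<open>N\<close>.\<close>

definition hadamard_compatible :: "nat \<Rightarrow> nat \<Rightarrow> (nat \<Rightarrow> nat \<Rightarrow> 'a :: field) \<Rightarrow> bool" where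
  "hadamard_compatible n N a \<longleftrightarrow>
     (\<forall>r\<in>{1..N}. \<forall>p<n. \<forall>q<n. (\<Sum>t<n. a p t ^ r * a t q) = a p q ^ Suc r)"

text \<open>Both kinds of power agree at exponent 1, so by induction they agree up to
  \<open>N + 1\<close> exactly when multiplication by \<open>A\<close> carries each Hadamard power
  to the next one.\<close>

lemma pow_mat_eq_hadamard_pow_iff:
  fixes A :: "'a :: field mat"
  assumes A: "A \<in> carrier_mat n n"
  shows "(\<forall>r\<in>{2..N + 1}. A ^\<^sub>m r = hadamard_pow A r) \<longleftrightarrow>
    hadamard_compatible n N (\<lambda>p q. A $$ (p, q))"
proof -
  have entry: "(hadamard_pow A r * A) $$ (p, q) = (\<Sum>t<n. (A $$ (p, t)) ^ r * A $$ (t, q))"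
    if "p < n" "q < n" for r p q
    using that A by (auto simp: hadamard_pow_def scalar_prod_def atLeast0LessThan)
  have *: "hadamard_pow A r * A = hadamard_pow A (Suc r) \<longleftrightarrow>
      (\<forall>p<n. \<forall>q<n. (\<Sum>t<n. (A $$ (p, t)) ^ r * A $$ (t, q)) = (A $$ (p, q)) ^ Suc r)" for r
  proof -
    have "hadamard_pow A r * A = hadamard_pow A (Suc r) \<longleftrightarrow>
        (\<forall>p<n. \<forall>q<n. (hadamard_pow A r * A) $$ (p, q) = hadamard_pow A (Suc r) $$ (p, q))"
      using A by (intro iffI, metis, intro eq_matI) (simp_all add: hadamard_pow_def)
    thus ?thesis
      using A entry by (simp add: hadamard_pow_def)
  qed
  have 1: "A ^\<^sub>m 1 = hadamard_pow A 1"
    using A by (intro eq_matI) (auto simp: hadamard_pow_def)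
  have "(\<forall>r\<in>{2..N + 1}. A ^\<^sub>m r = hadamard_pow A r) \<longleftrightarrow>
      (\<forall>r\<in>{1..N}. hadamard_pow A r * A = hadamard_pow A (Suc r))"
  proof safe
    fix r assume *: "\<forall>r\<in>{2..N + 1}. A ^\<^sub>m r = hadamard_pow A r" and r: "r \<in> {1..N}"
    have "A ^\<^sub>m r = hadamard_pow A r"
      using * r 1 by (cases "r = 1") auto
    moreover have "A ^\<^sub>m Suc r = hadamard_pow A (Suc r)"
      by (rule bspec[OF *]) (use r in auto)
    ultimately show "hadamard_pow A r * A = hadamard_pow A (Suc r)"
      by simp
  next
    fix r assume *: "\<forall>r\<in>{1..N}. hadamard_pow A r * A = hadamard_pow A (Suc r)" and "r \<in> {2..N + 1}"
    hence "1 \<le> r" "r \<le> N + 1" by auto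
    thus "A ^\<^sub>m r = hadamard_pow A r"
      by (induction r rule: dec_induct) (use 1 * in auto)
  qed
  thus ?thesis
    by (auto simp: * hadamard_compatible_def)
qed

text \<open>\<open>E\<^sub>\<mu> E\<^sub>\<nu> = \<delta>\<^sub>\<mu>\<^sub>\<nu> E\<^sub>\<nu>\<close> for the indicator matrices \<open>E\<^sub>\<mu>\<close> of the positions of the entry \<open>\<mu>\<close>.\<close>

definition orthogonal_levels :: "nat \<Rightarrow> (nat \<Rightarrow> nat \<Rightarrow> 'a :: field) \<Rightarrow> bool" where
  "orthogonal_levels n a \<longleftrightarrow> (\<forall>p<n. \<forall>q<n. \<forall>\<mu> \<nu>. \<mu> \<noteq> 0 \<longrightarrow> \<nu> \<noteq> 0 \<longrightarrow>
     (\<Sum>t<n. of_bool (a p t = \<mu> \<and> a t q = \<nu>) :: 'a) = of_bool (a p q = \<mu> \<and> a p q = \<nu>))"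

text \<open>Separation along a row gives \<open>E\<^sub>\<mu> A = \<mu> E\<^sub>\<mu>\<close>;
  induction lifts this to the Hadamard powers of \<open>A\<close>; separation along a column then
  replaces these powers by \<open>E\<^sub>\<nu>\<close>.\<close>

lemma hadamard_compatible_imp_orthogonal_levels:
  fixes a :: "nat \<Rightarrow> nat \<Rightarrow> 'a :: field"
  assumes H: "hadamard_compatible n n a"
  shows "orthogonal_levels n a"
proof -
  have H: "(\<Sum>t<n. a p t ^ r * a t q) = a p q ^ Suc r" if "r \<in> {1..n}" "p < n" "q < n" for p q r
    using H that by (simp add: hadamard_compatible_def)
  have EA: "(\<Sum>t<n. of_bool (a p t = \<mu>) * a t q) = of_bool (a p q = \<mu>) * \<mu>"
    if pq: "p < n" "q < n" and \<mu>: "\<mu> \<noteq> 0" for p q \<mu>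
  proof -
    \<comment> \<open>The right-hand side \<open>a p q ^ Suc r\<close> is absorbed as a correction
      at \<open>t = q\<close>, where the separated value \<open>a p t\<close> equals
      \<open>a p q\<close>.\<close>
    define b where "b t = a t q - of_bool (t = q) * a p q" for t
    have "(\<Sum>t<n. if a p t = \<mu> then b t else 0) = 0"
    proof (rule power_sums_eq_0_imp_fibre_sum_eq_0)
      fix r assume r: "r \<in> {1..n}"
      have "(\<Sum>t<n. b t * a p t ^ r) =
          (\<Sum>t<n. a p t ^ r * a t q) - (\<Sum>t<n. of_bool (t = q) * (a p q * a p q ^ r))"
        unfolding b_def sum_subtractf[symmetric] by (intro sum.cong) (auto simp: algebra_simps)
      also have "(\<Sum>t<n. of_bool (t = q) * (a p q * a p q ^ r)) = a p q * a p q ^ r"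
        using pq by simp
      finally show "(\<Sum>t<n. b t * a p t ^ r) = 0"
        using H[OF r pq] by simp
    qed (fact \<mu>)
    also have "(\<Sum>t<n. if a p t = \<mu> then b t else 0) =
        (\<Sum>t<n. of_bool (a p t = \<mu>) * a t q) - (\<Sum>t<n. of_bool (t = q) * (of_bool (a p q = \<mu>) * \<mu>))"
      unfolding b_def sum_subtractf[symmetric] by (intro sum.cong) auto
    also have "(\<Sum>t<n. of_bool (t = q) * (of_bool (a p q = \<mu>) * \<mu>)) = of_bool (a p q = \<mu>) * \<mu>"
      using pq by simp
    finally show ?thesis by simp
  qed
  \<comment> \<open>The induction replaces the Hadamard power \<open>r + 1\<close> by the Hadamard
    power \<open>r\<close> times \<open>A\<close>, so \<open>E\<^sub>\<mu>\<close> passes through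
    one factor at a time.\<close>
  have EA_pow: "(\<Sum>t<n. of_bool (a p t = \<mu>) * a t q ^ r) = of_bool (a p q = \<mu>) * \<mu> ^ r"
    if "r \<ge> 1" "r \<le> n" "p < n" "q < n" "\<mu> \<noteq> 0" for p q \<mu> r
    using that
  proof (induction r arbitrary: q rule: dec_induct)
    case base
    then show ?case using EA by simp
  next
    case (step r)
    have "(\<Sum>t<n. of_bool (a p t = \<mu>) * a t q ^ Suc r) =
        (\<Sum>t<n. of_bool (a p t = \<mu>) * (\<Sum>s<n. a t s ^ r * a s q))"
      using step by (intro sum.cong refl) (subst H, auto)
    also have "\<dots> = (\<Sum>s<n. (\<Sum>t<n. of_bool (a p t = \<mu>) * a t s ^ r) * a s q)"
      unfolding sum_distrib_left sum_distrib_right by (subst sum.swap) (simp add: mult.assoc)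
    also have "\<dots> = (\<Sum>s<n. of_bool (a p s = \<mu>) * \<mu> ^ r * a s q)"
      using step by (intro sum.cong refl arg_cong2[where f = "(*)"]) auto
    also have "\<dots> = \<mu> ^ r * (\<Sum>s<n. of_bool (a p s = \<mu>) * a s q)"
      unfolding sum_distrib_left by (intro sum.cong) (auto simp: algebra_simps)
    finally show ?case
      using step EA by simp
  qed
  show ?thesis
    unfolding orthogonal_levels_def
  proof (intro allI impI)
    fix p q and \<mu> \<nu> :: 'a
    assume pq: "p < n" "q < n" and nz: "\<mu> \<noteq> 0" "\<nu> \<noteq> 0"
    \<comment> \<open>Now the values \<open>a t q\<close> of column \<open>q\<close> are separated,
      so the correction sits at \<open>t = p\<close>.\<close>
    define b :: "nat \<Rightarrow> 'a" where "b t = of_bool (a p t = \<mu>) - of_bool (t = p) * of_bool (a p q = \<mu>)" for t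
    have "(\<Sum>t<n. if a t q = \<nu> then b t else 0) = 0"
    proof (rule power_sums_eq_0_imp_fibre_sum_eq_0)
      fix r assume r: "r \<in> {1..n}"
      have "(\<Sum>t<n. b t * a t q ^ r) =
          (\<Sum>t<n. of_bool (a p t = \<mu>) * a t q ^ r) - (\<Sum>t<n. of_bool (t = p) * (of_bool (a p q = \<mu>) * \<mu> ^ r))"
        unfolding b_def sum_subtractf[symmetric] by (intro sum.cong) (auto simp: algebra_simps)
      also have "(\<Sum>t<n. of_bool (t = p) * (of_bool (a p q = \<mu>) * \<mu> ^ r)) = of_bool (a p q = \<mu>) * \<mu> ^ r"
        using pq by simp
      finally show "(\<Sum>t<n. b t * a t q ^ r) = 0"
        using EA_pow r pq nz by simp
    qed (fact nz)
    also have "(\<Sum>t<n. if a t q = \<nu> then b t else 0) =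
        (\<Sum>t<n. of_bool (a p t = \<mu> \<and> a t q = \<nu>)) - (\<Sum>t<n. of_bool (t = p) * of_bool (a p q = \<mu> \<and> a p q = \<nu>))"
      unfolding b_def sum_subtractf[symmetric] by (intro sum.cong) auto
    also have "(\<Sum>t<n. of_bool (t = p) * of_bool (a p q = \<mu> \<and> a p q = \<nu>)) = (of_bool (a p q = \<mu> \<and> a p q = \<nu>) :: 'a)"
      unfolding sum_distrib_right[symmetric] using pq by simp
    finally show "(\<Sum>t<n. of_bool (a p t = \<mu> \<and> a t q = \<nu>) :: 'a) = of_bool (a p q = \<mu> \<and> a p q = \<nu>)"
      by simp
  qed
qed

section \<open>Power equations from orthogonal decompositions\<close>

text \<open>Disjoint supports make a Hadamard power raise the coefficients \<open>l i\<close>, and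
  orthogonality does the same for the product with \<open>A\<close>. Conditions (c) and (d) both
  reduce to this: \<open>e\<close> holds the idempotents in the first case and the outer products in
  the second.\<close>

lemma orthogonal_decomposition_imp_hadamard_compatible:
  fixes a :: "nat \<Rightarrow> nat \<Rightarrow> 'a :: field" and e :: "'i \<Rightarrow> nat \<Rightarrow> nat \<Rightarrow> 'a"
  assumes fin: "finite I"
    and a: "\<And>p q. p < n \<Longrightarrow> q < n \<Longrightarrow> a p q = (\<Sum>i\<in>I. l i * e i p q)"
    and zero_one: "\<And>i p q. i \<in> I \<Longrightarrow> p < n \<Longrightarrow> q < n \<Longrightarrow> e i p q \<in> {0, 1}"
    and disj: "\<And>i j p q. i \<in> I \<Longrightarrow> j \<in> I \<Longrightarrow> i \<noteq> j \<Longrightarrow> p < n \<Longrightarrow> q < n \<Longrightarrow> e i p q = 0 \<or> e j p q = 0"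
    and orth: "\<And>i j p q. i \<in> I \<Longrightarrow> j \<in> I \<Longrightarrow> p < n \<Longrightarrow> q < n \<Longrightarrow>
      (\<Sum>t<n. e i p t * e j t q) = (if i = j then e i p q else 0)"
  shows "hadamard_compatible n N a"
proof -
  \<comment> \<open>The bound \<open>r \<ge> 1\<close> matters outside all supports, where the
    right-hand side is 0 but a zeroth power would be 1.\<close>
  have pow: "a p q ^ r = (\<Sum>i\<in>I. l i ^ r * e i p q)" if pq: "p < n" "q < n" and r: "r \<ge> 1" for p q r
  proof (cases "\<exists>i\<in>I. e i p q \<noteq> 0")
    case True
    then obtain i where i: "i \<in> I" "e i p q \<noteq> 0" by blast
    have e: "e j p q = of_bool (j = i)" if "j \<in> I" for j
      using disj[OF that i(1) _ pq] zero_one[OF i(1) pq] i that by auto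
    show ?thesis
      using i fin by (simp add: a pq e)
  next
    case False
    thus ?thesis using r by (simp add: a pq)
  qed
  have "(\<Sum>t<n. a p t ^ r * a t q) = a p q ^ Suc r" if pq: "p < n" "q < n" and r: "r \<ge> 1" for p q r
  proof -
    have "(\<Sum>t<n. a p t ^ r * a t q) = (\<Sum>t<n. \<Sum>i\<in>I. \<Sum>j\<in>I. l i ^ r * l j * (e i p t * e j t q))"
      unfolding sum_product using pq r
      by (intro sum.cong refl, simp only: lessThan_iff pow)
        (simp only: a sum_product mult.assoc mult.left_commute)
    also have "\<dots> = (\<Sum>i\<in>I. \<Sum>t<n. \<Sum>j\<in>I. l i ^ r * l j * (e i p t * e j t q))"
      by (rule sum.swap)
    also have "\<dots> = (\<Sum>i\<in>I. \<Sum>j\<in>I. l i ^ r * l j * (\<Sum>t<n. e i p t * e j t q))"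
      unfolding sum_distrib_left by (intro sum.cong refl sum.swap)
    also have "\<dots> = (\<Sum>i\<in>I. \<Sum>j\<in>I. if i = j then l i ^ Suc r * e i p q else 0)"
      using pq by (intro sum.cong refl) (simp add: orth)
    also have "\<dots> = (\<Sum>i\<in>I. l i ^ Suc r * e i p q)"
      using fin by simp
    also have "\<dots> = a p q ^ Suc r"
      by (rule pow[OF pq, symmetric]) simp
    finally show ?thesis .
  qed
  thus ?thesis
    by (auto simp: hadamard_compatible_def)
qed

section \<open>Entries of sums, outer products, blocks and permuted matrices\<close>

lemma msum_index:
  fixes f :: "'i \<Rightarrow> 'a :: comm_ring_1 mat"
  assumes "finite I" "\<And>i. i \<in> I \<Longrightarrow> f i \<in> carrier_mat n n"
  shows "msum n f I \<in> carrier_mat n n"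
    and "p < n \<Longrightarrow> q < n \<Longrightarrow> msum n f I $$ (p, q) = (\<Sum>i\<in>I. f i $$ (p, q))"
proof -
  interpret abelian_group "module_mat TYPE('a) n n"
    by (rule abelian_group_mat)
  have "msum n f I \<in> carrier_mat n n \<and>
      (p < n \<longrightarrow> q < n \<longrightarrow> msum n f I $$ (p, q) = (\<Sum>i\<in>I. f i $$ (p, q)))"
    using assms
  proof (induction I rule: finite_induct)
    case empty
    show ?case by (simp add: finsum_empty[unfolded module_mat_simps] module_mat_simps)
  next
    case (insert i I)
    have "msum n f (insert i I) = f i + msum n f I"
      using insert finsum_insert[of I i f] by (auto simp: module_mat_simps)
    moreover have "msum n f I \<in> carrier_mat n n" "f i \<in> carrier_mat n n"
      using insert by auto
    ultimately show ?case
      using insert by auto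
  qed
  thus "msum n f I \<in> carrier_mat n n"
    "p < n \<Longrightarrow> q < n \<Longrightarrow> msum n f I $$ (p, q) = (\<Sum>i\<in>I. f i $$ (p, q))" by auto
qed

lemma outer_prod_carrier [simp]: "outer_prod v w \<in> carrier_mat (dim_vec v) (dim_vec w)"
  by (rule carrier_matI) (simp_all add: outer_prod_def)

lemma outer_prod_index:
  "i < dim_vec v \<Longrightarrow> j < dim_vec w \<Longrightarrow> outer_prod v w $$ (i, j) = v $ i * w $ j"
  by (simp add: outer_prod_def scalar_prod_def)

lemma row_blocks_carrier:
  "U \<in> carrier_mat m a \<Longrightarrow> row_blocks m b c U \<in> carrier_mat m (m + a + b + c)"
  by (auto simp: row_blocks_def append_cols_def)

lemma col_blocks_carrier:
  "V \<in> carrier_mat b m \<Longrightarrow> col_blocks m a c V \<in> carrier_mat (m + a + b + c) m"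
  by (auto simp: col_blocks_def append_rows_def)

lemma row_blocks_index:
  assumes "U \<in> carrier_mat m a" "i < m" "j < m + a + b + c"
  shows "row_blocks m b c U $$ (i, j) =
    (if j < m then of_bool (i = j) else if j < m + a then U $$ (i, j - m) else 0)"
  using assms by (auto simp: row_blocks_def append_cols_def)

lemma col_blocks_index:
  assumes "V \<in> carrier_mat b m" "i < m + a + b + c" "j < m"
  shows "col_blocks m a c V $$ (i, j) =
    (if i < m then of_bool (i = j) else if m + a \<le> i \<and> i < m + a + b then V $$ (i - m - a, j) else 0)"
  using assms by (auto simp: col_blocks_def append_rows_def)

lemma permutation_conjugate_index:
  fixes A :: "'a :: comm_ring_1 mat"
  assumes p: "p permutes {..<n}" and P: "P = mat n n (\<lambda>(i, j). if j = p i then 1 else 0)"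
    and A: "A \<in> carrier_mat n n"
  shows "P * A * transpose_mat P \<in> carrier_mat n n"
    and "i < n \<Longrightarrow> j < n \<Longrightarrow> (P * A * transpose_mat P) $$ (i, j) = A $$ (p i, p j)"
proof -
  show "P * A * transpose_mat P \<in> carrier_mat n n"
    using A by (auto simp: P)
  assume ij: "i < n" "j < n"
  have lt: "p i < n" if "i < n" for i
    using permutes_in_image[OF p, of i] that by auto
  have PA: "(P * A) $$ (i, t) = A $$ (p i, t)" if "t < n" for t
  proof -
    have "(P * A) $$ (i, t) = (\<Sum>s<n. (if s = p i then 1 else 0) * A $$ (s, t))"
      using A ij that by (simp add: P scalar_prod_def atLeast0LessThan)
    also have "\<dots> = (\<Sum>s<n. if s = p i then A $$ (p i, t) else 0)"
      by (intro sum.cong) auto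
    also have "\<dots> = A $$ (p i, t)"
      using lt[OF ij(1)] by simp
    finally show ?thesis .
  qed
  have "(P * A * transpose_mat P) $$ (i, j) = (\<Sum>t<n. (P * A) $$ (i, t) * P $$ (j, t))"
    using A ij by (simp add: P scalar_prod_def atLeast0LessThan)
  also have "\<dots> = (\<Sum>t<n. if t = p j then A $$ (p i, p j) else 0)"
    using ij PA by (intro sum.cong) (auto simp: P)
  also have "\<dots> = A $$ (p i, p j)"
    using lt[OF ij(2)] by simp
  finally show "(P * A * transpose_mat P) $$ (i, j) = A $$ (p i, p j)" .
qed

text \<open>The equations are invariant under relabelling the indices: the summation index is
  permuted along with \<open>x\<close> and \<open>y\<close>.\<close>

lemma hadamard_compatible_permutes:
  assumes p: "p permutes {..<n}" and H: "hadamard_compatible n N (\<lambda>i j. a (p i) (p j))"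
  shows "hadamard_compatible n N a"
  unfolding hadamard_compatible_def
proof (intro ballI allI impI)
  fix r x y assume r: "r \<in> {1..N}" and xy: "x < n" "y < n"
  from xy obtain i j where ij: "x = p i" "y = p j" "i < n" "j < n"
    using permutes_image[OF p] by (metis imageE lessThan_iff)
  have "(\<Sum>t<n. a x t ^ r * a t y) = (\<Sum>t<n. a x (p t) ^ r * a (p t) y)"
    by (rule sum.permute[OF p, unfolded comp_def])
  thus "(\<Sum>t<n. a x t ^ r * a t y) = a x y ^ Suc r"
    using H ij r by (simp add: hadamard_compatible_def)
qed

section \<open>Unique midpoints in the digraph of non-zero entries\<close>

text \<open>This is where the characteristic enters: equality in the field is congruence modulo the
  characteristic, which is equality for counts up to \<open>n\<close>.\<close>

lemma of_nat_inj_CHAR: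
  assumes "CHAR('a :: semiring_1_cancel) = 0 \<or> CHAR('a) > n" "x \<le> n" "y \<le> n" "of_nat x = (of_nat y :: 'a)"
  shows "x = y"
  using assms by (auto simp: of_nat_eq_iff_cong_CHAR cong_def)

text \<open>In the digraph of non-zero entries, \<open>mid_eq\<close> contains transitivity: the
  entry at \<open>(p, q)\<close> equals a non-zero one.\<close>

locale unique_midpoints =
  fixes n :: nat and a :: "nat \<Rightarrow> nat \<Rightarrow> 'a :: field"
  assumes mid_eq: "p < n \<Longrightarrow> q < n \<Longrightarrow> t < n \<Longrightarrow> a p t \<noteq> 0 \<Longrightarrow> a t q \<noteq> 0 \<Longrightarrow>
      a p t = a p q \<and> a t q = a p q"
    and mid_ex: "p < n \<Longrightarrow> q < n \<Longrightarrow> a p q \<noteq> 0 \<Longrightarrow> \<exists>t<n. a p t \<noteq> 0 \<and> a t q \<noteq> 0"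
    and mid_unique: "p < n \<Longrightarrow> q < n \<Longrightarrow> t < n \<Longrightarrow> t' < n \<Longrightarrow> a p t \<noteq> 0 \<Longrightarrow> a t q \<noteq> 0 \<Longrightarrow>
      a p t' \<noteq> 0 \<Longrightarrow> a t' q \<noteq> 0 \<Longrightarrow> t = t'"

lemma orthogonal_levels_imp_unique_midpoints:
  fixes a :: "nat \<Rightarrow> nat \<Rightarrow> 'a :: field"
  assumes L: "orthogonal_levels n a" and char: "CHAR('a) = 0 \<or> CHAR('a) > n" and n: "n > 0"
  shows "unique_midpoints n a"
proof -
  \<comment> \<open>The field identity becomes one of naturals, as both sides are at most
    \<open>n\<close>; for the right-hand side this uses \<open>n > 0\<close>.\<close>
  have count: "card {t. t < n \<and> a p t = \<mu> \<and> a t q = \<nu>} = of_bool (a p q = \<mu> \<and> a p q = \<nu>)"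
    if "p < n" "q < n" "\<mu> \<noteq> 0" "\<nu> \<noteq> 0" for p q \<mu> \<nu>
  proof (rule of_nat_inj_CHAR[OF char])
    have "card {t. t < n \<and> a p t = \<mu> \<and> a t q = \<nu>} \<le> card {..<n}"
      by (intro card_mono) auto
    thus "card {t. t < n \<and> a p t = \<mu> \<and> a t q = \<nu>} \<le> n" by simp
    have "(of_nat (card {t. t < n \<and> a p t = \<mu> \<and> a t q = \<nu>}) :: 'a) =
        (\<Sum>t<n. of_bool (a p t = \<mu> \<and> a t q = \<nu>))"
      by (simp add: Int_def)
    also have "\<dots> = of_bool (a p q = \<mu> \<and> a p q = \<nu>)"
      using L that unfolding orthogonal_levels_def by blast
    finally show "(of_nat (card {t. t < n \<and> a p t = \<mu> \<and> a t q = \<nu>}) :: 'a) =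
        of_nat (of_bool (a p q = \<mu> \<and> a p q = \<nu>))" by simp
  qed (use n in auto)
  \<comment> \<open>Take the levels of the two arcs themselves: \<open>t\<close> is then counted, so
    the count is not 0 and the indicator on the right must be true.\<close>
  have mid_eq: "a p t = a p q \<and> a t q = a p q"
    if "p < n" "q < n" "t < n" "a p t \<noteq> 0" "a t q \<noteq> 0" for p q t
  proof (rule ccontr)
    assume "\<not> ?thesis"
    hence "card {s. s < n \<and> a p s = a p t \<and> a s q = a t q} = 0"
      using count[OF that(1,2,4,5)] by auto
    thus False
      using that(3) by auto
  qed
  show ?thesis
  proof
    fix p q assume pq: "p < n" "q < n"
    {
      assume "a p q \<noteq> 0"
      with count[OF pq this this] have "card {t. t < n \<and> a p t = a p q \<and> a t q = a p q} = 1"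
        by simp
      then obtain t where "{t. t < n \<and> a p t = a p q \<and> a t q = a p q} = {t}"
        by (auto simp: card_1_singleton_iff)
      with \<open>a p q \<noteq> 0\<close> show "\<exists>t<n. a p t \<noteq> 0 \<and> a t q \<noteq> 0"
        by (metis (mono_tags, lifting) mem_Collect_eq singletonI)
    }
    fix t t' assume t: "t < n" "t' < n" "a p t \<noteq> 0" "a t q \<noteq> 0" "a p t' \<noteq> 0" "a t' q \<noteq> 0"
    \<comment> \<open>By \<open>mid_eq\<close> both midpoints lie in the level of
      \<open>a p q\<close>, where the count is 1.\<close>
    have "a p q \<noteq> 0" using mid_eq[OF pq t(1,3,4)] t by auto
    with count[OF pq this this] have "card {t. t < n \<and> a p t = a p q \<and> a t q = a p q} = 1"
      by simp
    then obtain s where "{t. t < n \<and> a p t = a p q \<and> a t q = a p q} = {s}"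
      by (auto simp: card_1_singleton_iff)
    moreover have "t \<in> {t. t < n \<and> a p t = a p q \<and> a t q = a p q}"
      "t' \<in> {t. t < n \<and> a p t = a p q \<and> a t q = a p q}"
      using mid_eq[OF pq t(1,3,4)] mid_eq[OF pq t(2,5,6)] t by auto
    ultimately show "t = t'" by auto
  qed (fact mid_eq)+
qed

context unique_midpoints
begin

definition loops :: "nat set" where "loops = {d. d < n \<and> a d d \<noteq> 0}"

lemma loops_subset: "loops \<subseteq> {..<n}"
  by (auto simp: loops_def)

lemma finite_loops [simp]: "finite loops"
  by (simp add: loops_def)

text \<open>The midpoint \<open>s\<close> of \<open>p \<rightarrow> t\<close> is also a midpoint of \<open>p \<rightarrow> q\<close>, so \<open>s = t\<close> and \<open>t\<close> carries a loop.\<close>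

lemma mid_in_loops:
  assumes "p < n" "q < n" "t < n" "a p t \<noteq> 0" "a t q \<noteq> 0"
  shows "t \<in> loops" "a t t = a p q"
proof -
  obtain s where s: "s < n" "a p s \<noteq> 0" "a s t \<noteq> 0"
    using mid_ex[of p t] assms by blast
  have "a s q \<noteq> 0"
    using mid_eq[of s q t] s assms by auto
  hence "s = t"
    using mid_unique[of p q s t] s assms by auto
  with s have tt: "a t t \<noteq> 0" by simp
  thus "t \<in> loops"
    using assms by (simp add: loops_def)
  show "a t t = a p q"
    using mid_eq[of p t t] mid_eq[of p q t] assms tt by auto
qed

text \<open>Both ends of an arc between two loops are midpoints of it, hence equal.\<close>

lemma loops_discrete: "d \<in> loops \<Longrightarrow> d' \<in> loops \<Longrightarrow> a d d' \<noteq> 0 \<longleftrightarrow> d = d'"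
  using mid_unique[of d d' d d'] by (auto simp: loops_def)

text \<open>At most one term survives, that of the midpoint of \<open>(p, q)\<close>, which is a
  loop of value \<open>a p q\<close>. The weights \<open>a d d\<close> recover the entries of the
  matrix, the weight 1 its zero-one pattern.\<close>

lemma sum_over_loops:
  fixes w :: "nat \<Rightarrow> 'b :: semiring_1"
  assumes "p < n" "q < n"
    and "\<And>d. d \<in> loops \<Longrightarrow> a d d = a p q \<Longrightarrow> w d = v"
  shows "(\<Sum>d\<in>loops. w d * (of_bool (a p d \<noteq> 0) * of_bool (a d q \<noteq> 0))) = v * of_bool (a p q \<noteq> 0)"
proof (cases "a p q = 0")
  case True
  have "w d * (of_bool (a p d \<noteq> 0) * of_bool (a d q \<noteq> 0)) = 0" if "d \<in> loops" for d
    using mid_eq[of p q d] that True assms(1,2) by (auto simp: loops_def)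
  thus ?thesis
    using True by (subst sum.neutral) auto
next
  case False
  then obtain t where t: "t < n" "a p t \<noteq> 0" "a t q \<noteq> 0"
    using mid_ex assms(1,2) by blast
  note tl = mid_in_loops[OF assms(1,2) t]
  have "(\<Sum>d\<in>loops. w d * (of_bool (a p d \<noteq> 0) * of_bool (a d q \<noteq> 0))) = (\<Sum>d\<in>loops. if d = t then w t else 0)"
  proof (intro sum.cong refl)
    fix d assume "d \<in> loops"
    hence "d = t" if "a p d \<noteq> 0" "a d q \<noteq> 0"
      using mid_unique[OF assms(1,2) _ t(1) that t(2,3)] by (simp add: loops_def)
    thus "w d * (of_bool (a p d \<noteq> 0) * of_bool (a d q \<noteq> 0)) = (if d = t then w t else 0)"
      using t by (cases "d = t") auto
  qed
  thus ?thesis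
    using False tl(1) assms(3)[OF tl] by simp
qed

text \<open>One rank-one term for each loop; both the rank and the block form are read off from
  it.\<close>

corollary entry_eq_sum_loops:
  assumes "p < n" "q < n"
  shows "a p q = (\<Sum>d\<in>loops. a d d * (of_bool (a p d \<noteq> 0) * of_bool (a d q \<noteq> 0)))"
  by (subst sum_over_loops[OF assms]) auto

end

section \<open>A criterion for the rank\<close>

text \<open>The columns indexed by \<open>D\<close> are independent, since coordinate
  \<open>d\<close> isolates the coefficient of column \<open>d\<close>, and they span all columns.
  They thus form a maximal independent set of columns.\<close>

lemma (in vec_space) rank_eq_card_if_diagonal:
  assumes A: "A \<in> carrier_mat n nc" and D: "D \<subseteq> {..<n}" "D \<subseteq> {..<nc}"
    and diag: "\<And>d d'. d \<in> D \<Longrightarrow> d' \<in> D \<Longrightarrow> A $$ (d, d') \<noteq> 0 \<longleftrightarrow> d = d'"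
    and span: "\<And>q. q < nc \<Longrightarrow> \<exists>x. \<forall>p<n. A $$ (p, q) = (\<Sum>d\<in>D. x d * A $$ (p, d))"
  shows "rank A = card D"
proof -
  define S where "S = col A ` D"
  have fin: "finite D" using D(1) finite_subset by auto
  \<comment> \<open>Independence concerns a set of vectors, so different indices in \<open>D\<close>
    must yield different columns.\<close>
  have inj: "inj_on (col A) D"
  proof (rule inj_onI)
    fix d d' assume d: "d \<in> D" "d' \<in> D" and eq: "col A d = col A d'"
    have "A $$ (d, d) = col A d $ d" "A $$ (d, d') = col A d' $ d"
      using A D d by (simp_all add: subset_iff)
    thus "d = d'"
      using diag[OF d] diag[OF d(1) d(1)] eq by auto
  qed
  have S: "finite S" "S \<subseteq> carrier_vec n" "S \<subseteq> set (cols A)" "card S = card D"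
    using A D fin by (auto simp: S_def card_image[OF inj] cols_def)
  have lc: "lincomb f S $ p = (\<Sum>d\<in>D. f (col A d) * A $$ (p, d))" if "p < n" for f p
    using A D that S lincomb_index[OF that S(2), of f]
    by (auto simp: S_def sum.reindex[OF inj] intro!: sum.cong)
  have indpt: "lin_indpt S"
  proof (rule finite_lin_indpt2[OF S(1)])
    fix f assume f: "lincomb f S = 0\<^sub>v n"
    show "\<forall>v\<in>S. f v = 0"
    proof
      fix v assume "v \<in> S"
      then obtain d where d: "d \<in> D" "v = col A d" by (auto simp: S_def)
      have dn: "d < n" using d D by auto
      have "0 = lincomb f S $ d"
        using f dn by simp
      also have "\<dots> = (\<Sum>e\<in>D. f (col A e) * A $$ (d, e))"
        using lc[OF dn] .
      also have "\<dots> = (\<Sum>e\<in>D. if e = d then f v * A $$ (d, d) else 0)"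
        using diag d by (intro sum.cong) auto
      also have "\<dots> = f v * A $$ (d, d)"
        using d fin by simp
      finally show "f v = 0"
        using diag[OF d(1) d(1)] by auto
    qed
  qed (use S in simp)
  have in_span: "v \<in> span S" if v: "v \<in> set (cols A)" for v
  proof -
    obtain q where q: "q < nc" "v = col A q"
      using v A by (auto simp: cols_def)
    obtain x where x: "\<And>p. p < n \<Longrightarrow> A $$ (p, q) = (\<Sum>d\<in>D. x d * A $$ (p, d))"
      using span[OF q(1)] by blast
    \<comment> \<open>Coefficients are given by index but a linear combination takes them by vector;
      injectivity allows the translation.\<close>
    define f where "f = x \<circ> the_inv_into D (col A)"
    have "v = lincomb f S"
    proof (rule eq_vecI)
      show "dim_vec v = dim_vec (lincomb f S)"
        using A q lincomb_dim[OF S(1,2)] by simp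
      fix p assume "p < dim_vec (lincomb f S)"
      hence p: "p < n" using lincomb_dim[OF S(1,2)] by simp
      show "v $ p = lincomb f S $ p"
        using A q p x[OF p] by (auto simp: lc f_def the_inv_into_f_f[OF inj] intro!: sum.cong)
    qed
    thus ?thesis
      using S(1) by (intro in_spanI) auto
  qed
  have "maximal S (\<lambda>T. T \<subseteq> set (cols A) \<and> lin_indpt T)"
    unfolding maximal_def
  proof (intro conjI allI impI)
    fix T assume T: "S \<subseteq> T \<and> T \<subseteq> set (cols A) \<and> lin_indpt T"
    show "T = S"
    proof (rule ccontr)
      assume "T \<noteq> S"
      then obtain v where v: "v \<in> T" "v \<notin> S" using T by auto
      have vA: "v \<in> set (cols A)" using v T by auto
      hence "v \<in> carrier_vec n" using A cols_dim[of A] by auto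
      hence "lin_dep (S \<union> {v})"
        using lin_dep_iff_in_span[of S v] S(2) indpt v(2) in_span[OF vA] by (auto simp: module_vec_simps)
      thus False
        using T v supset_ld_is_ld[of "S \<union> {v}" T] by auto
    qed
  qed (use S indpt in auto)
  from rank_card_indpt[OF A this] S(4) show ?thesis by simp
qed

section \<open>The decomposition into idempotents\<close>

lemma zero_one_mat_iff:
  "A \<in> carrier_mat nr nc \<Longrightarrow> zero_one_mat A \<longleftrightarrow> (\<forall>i<nr. \<forall>j<nc. A $$ (i, j) = 0 \<or> A $$ (i, j) = 1)"
  by (fastforce simp: zero_one_mat_def)

lemma spectral_decomposition_imp_hadamard_compatible:
  fixes A :: "'a :: field mat" and k :: nat
  assumes E: "\<And>i. i < k \<Longrightarrow> E i \<in> carrier_mat n n \<and> idempotent_mat (E i) \<and> zero_one_mat (E i)"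
    and A: "A = msum n (\<lambda>i. l i \<cdot>\<^sub>m E i) {..<k}"
    and orth: "\<And>i j. i < k \<Longrightarrow> j < k \<Longrightarrow> i \<noteq> j \<Longrightarrow> E i \<circ>\<^sub>H E j = 0\<^sub>m n n \<and> E i * E j = 0\<^sub>m n n"
  shows "hadamard_compatible n N (\<lambda>p q. A $$ (p, q))"
proof (rule orthogonal_decomposition_imp_hadamard_compatible[where I = "{..<k}" and l = l
      and e = "\<lambda>i p q. E i $$ (p, q)"])
  fix p q assume pq: "p < n" "q < n"
  have sm: "l i \<cdot>\<^sub>m E i \<in> carrier_mat n n" if "i \<in> {..<k}" for i
    using E that by simp
  have "A $$ (p, q) = (\<Sum>i<k. (l i \<cdot>\<^sub>m E i) $$ (p, q))"
    unfolding A using pq by (intro msum_index(2) sm) auto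
  also have "\<dots> = (\<Sum>i<k. l i * E i $$ (p, q))"
    using E pq by (intro sum.cong refl) (metis carrier_matD index_smult_mat(1) lessThan_iff)
  finally show "A $$ (p, q) = (\<Sum>i<k. l i * E i $$ (p, q))" .
next
  fix i p q assume "i \<in> {..<k}" "p < n" "q < n"
  thus "E i $$ (p, q) \<in> {0, 1}"
    using E[of i] zero_one_mat_iff[of "E i" n n] by auto
next
  fix i j p q assume i: "i \<in> {..<k}" "j \<in> {..<k}" "i \<noteq> j" and pq: "p < n" "q < n"
  have "(E i \<circ>\<^sub>H E j) $$ (p, q) = 0"
    using orth[of i j] i pq by simp
  thus "E i $$ (p, q) = 0 \<or> E j $$ (p, q) = 0"
    using E[of i] E[of j] i pq by (auto simp: hadamard_prod_def)
next
  fix i j p q assume i: "i \<in> {..<k}" "j \<in> {..<k}" and pq: "p < n" "q < n"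
  have "(\<Sum>t<n. E i $$ (p, t) * E j $$ (t, q)) = (E i * E j) $$ (p, q)"
    using E[of i] E[of j] i pq by (auto simp: scalar_prod_def atLeast0LessThan)
  also have "\<dots> = (if i = j then E i $$ (p, q) else 0)"
    using E[of i] orth[of i j] i pq by (auto simp: idempotent_mat_def)
  finally show "(\<Sum>t<n. E i $$ (p, t) * E j $$ (t, q)) = (if i = j then E i $$ (p, q) else 0)" .
qed simp

text \<open>The level matrices are the idempotents: \<open>l\<close> enumerates the distinct
  non-zero entries, and \<open>E i\<close> marks the positions of \<open>l i\<close>. As
  \<open>A\<close> is non-zero, there is at least one.\<close>

lemma orthogonal_levels_imp_spectral_decomposition:
  fixes A :: "'a :: field mat"
  assumes A: "A \<in> carrier_mat n n" "A \<noteq> 0\<^sub>m n n" and L: "orthogonal_levels n (\<lambda>p q. A $$ (p, q))"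
  shows "\<exists>(k::nat) (l::nat \<Rightarrow> 'a) (E::nat \<Rightarrow> 'a mat).
           k > 0 \<and> inj_on l {..<k} \<and>
           (\<forall>i<k. l i \<noteq> 0 \<and> E i \<in> carrier_mat n n \<and> idempotent_mat (E i) \<and> zero_one_mat (E i)) \<and>
           A = msum n (\<lambda>i. l i \<cdot>\<^sub>m E i) {..<k} \<and>
           (\<forall>i<k. \<forall>j<k. i \<noteq> j \<longrightarrow> E i \<circ>\<^sub>H E j = 0\<^sub>m n n \<and> E i * E j = 0\<^sub>m n n)"
proof -
  define X where "X = elements_mat A - {0}"
  have fin: "finite X" by (simp add: X_def elements_mat_def)
  obtain p q where pq: "p < n" "q < n" "A $$ (p, q) \<noteq> 0"
    using A by (auto simp: mat_eq_iff)
  hence "X \<noteq> {}" using A by (auto simp: X_def)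
  obtain l where l: "bij_betw l {..<card X} X"
    using ex_bij_betw_nat_finite[OF fin] by (auto simp: atLeast0LessThan)
  define E where "E i = mat n n (\<lambda>(p, q). of_bool (A $$ (p, q) = l i) :: 'a)" for i
  have inj: "inj_on l {..<card X}" using l by (rule bij_betw_imp_inj_on)
  have l0: "l i \<noteq> 0" if "i < card X" for i
    using bij_betwE[OF l] that by (auto simp: X_def)
  have EE: "E i * E j = (if i = j then E i else 0\<^sub>m n n)" if "i < card X" "j < card X" for i j
  proof (rule eq_matI)
    fix p q assume "p < dim_row (if i = j then E i else 0\<^sub>m n n)" "q < dim_col (if i = j then E i else 0\<^sub>m n n)"
    hence pq: "p < n" "q < n" by (auto simp: E_def split: if_splits)
    have "(E i * E j) $$ (p, q) = (\<Sum>t<n. of_bool (A $$ (p, t) = l i) * of_bool (A $$ (t, q) = l j))"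
      using pq by (simp add: E_def scalar_prod_def atLeast0LessThan)
    also have "\<dots> = (\<Sum>t<n. of_bool (A $$ (p, t) = l i \<and> A $$ (t, q) = l j))"
      by (simp only: of_bool_conj)
    also have "\<dots> = of_bool (A $$ (p, q) = l i \<and> A $$ (p, q) = l j)"
      using L pq l0 that unfolding orthogonal_levels_def by blast
    also have "\<dots> = (if i = j then E i else 0\<^sub>m n n) $$ (p, q)"
      using inj that pq by (auto simp: E_def inj_on_def)
    finally show "(E i * E j) $$ (p, q) = (if i = j then E i else 0\<^sub>m n n) $$ (p, q)" .
  qed (auto simp: E_def)
  have EH: "E i \<circ>\<^sub>H E j = 0\<^sub>m n n" if "i < card X" "j < card X" "i \<noteq> j" for i j
    using inj that by (intro eq_matI) (auto simp: E_def hadamard_prod_def inj_on_def)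
  have sm: "l i \<cdot>\<^sub>m E i \<in> carrier_mat n n" for i
    by (simp add: E_def)
  have "A = msum n (\<lambda>i. l i \<cdot>\<^sub>m E i) {..<card X}"
  proof (rule eq_matI)
    let ?M = "msum n (\<lambda>i. l i \<cdot>\<^sub>m E i) {..<card X}"
    have M: "?M \<in> carrier_mat n n" by (intro msum_index(1) sm) auto
    show "dim_row A = dim_row ?M" "dim_col A = dim_col ?M" using A M by auto
    fix p q assume "p < dim_row ?M" "q < dim_col ?M"
    hence pq: "p < n" "q < n" using M by auto
    have "?M $$ (p, q) = (\<Sum>i<card X. (l i \<cdot>\<^sub>m E i) $$ (p, q))"
      using pq by (intro msum_index(2) sm) auto
    also have "\<dots> = (\<Sum>i<card X. l i * of_bool (A $$ (p, q) = l i))"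
      using pq by (simp add: E_def)
    also have "\<dots> = (\<Sum>x\<in>X. x * of_bool (A $$ (p, q) = x))"
      by (rule sum.reindex_bij_betw[OF l])
    \<comment> \<open>A zero entry is not in \<open>X\<close>, so the sum is then 0, as it should
      be.\<close>
    also have "\<dots> = (\<Sum>x\<in>X. if x = A $$ (p, q) then A $$ (p, q) else 0)"
      by (intro sum.cong) auto
    also have "\<dots> = A $$ (p, q)"
      using fin A pq by (auto simp: X_def)
    finally show "A $$ (p, q) = ?M $$ (p, q)" by simp
  qed
  moreover have "card X > 0" using fin \<open>X \<noteq> {}\<close> by (simp add: card_gt_0_iff)
  moreover have "\<forall>i<card X. l i \<noteq> 0 \<and> E i \<in> carrier_mat n n \<and> idempotent_mat (E i) \<and> zero_one_mat (E i)"
    using l0 EE by (auto simp: idempotent_mat_def zero_one_mat_iff[of _ n n] E_def)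
  moreover have "\<forall>i<card X. \<forall>j<card X. i \<noteq> j \<longrightarrow> E i \<circ>\<^sub>H E j = 0\<^sub>m n n \<and> E i * E j = 0\<^sub>m n n"
    using EE EH by auto
  ultimately show ?thesis
    using inj by blast
qed

section \<open>Power equations from the block form\<close>

text \<open>The sum is the number of ones, read in the field. This number is at most
  \<open>n\<close>, so by the assumption on the characteristic it is 0 or 1 as a natural number
  too.\<close>

lemma at_most_one_if_sum_zero_one:
  fixes x :: "nat \<Rightarrow> 'a :: field"
  assumes char: "CHAR('a) = 0 \<or> CHAR('a) > n" and "m \<le> n" "n > 0"
    and x: "\<And>d. d < m \<Longrightarrow> x d \<in> {0, 1}" and sum: "(\<Sum>d<m. x d) \<in> {0, 1}"
    and d: "d < m" "d' < m" "d \<noteq> d'"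
  shows "x d = 0 \<or> x d' = 0"
proof (rule ccontr)
  assume "\<not> ?thesis"
  hence dd: "{d, d'} \<subseteq> {d. d < m \<and> x d = 1}" using x d by auto
  have "card {d. d < m \<and> x d = 1} \<le> card {..<m}"
    by (intro card_mono) auto
  hence le: "card {d. d < m \<and> x d = 1} \<le> n" using \<open>m \<le> n\<close> by simp
  have "(\<Sum>d<m. x d) = (\<Sum>d<m. of_bool (x d = 1))"
    using x by (intro sum.cong) auto
  also have "\<dots> = of_nat (card {d. d < m \<and> x d = 1})"
    by (simp add: Int_def)
  finally have "of_nat (card {d. d < m \<and> x d = 1}) = (of_nat 0 :: 'a) \<or>
      of_nat (card {d. d < m \<and> x d = 1}) = (of_nat 1 :: 'a)"
    using sum by simp
  hence "card {d. d < m \<and> x d = 1} = 0 \<or> card {d. d < m \<and> x d = 1} = 1"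
    using of_nat_inj_CHAR[OF char le, of 0] of_nat_inj_CHAR[OF char le, of 1] \<open>n > 0\<close>
    by (elim disjE) (simp_all only: Suc_le_eq One_nat_def zero_le simp_thms)
  hence "card {d. d < m \<and> x d = 1} \<le> 1"
    by linarith
  moreover have "card {d, d'} \<le> card {d. d < m \<and> x d = 1}"
    by (intro card_mono dd) auto
  ultimately show False using d by simp
qed

text \<open>Let \<open>C\<close> and \<open>R\<close> be the block column and the block row. The
  outer products are orthogonal because \<open>R * C\<close> is the identity, and have disjoint
  supports because \<open>C * R\<close> is a zero-one matrix, its only critical block being
  \<open>V * U\<close>.\<close>

lemma block_form_imp_hadamard_compatible:
  fixes A :: "'a :: field mat"
  assumes char: "CHAR('a) = 0 \<or> CHAR('a) > n" and n: "n > 0" and A: "A \<in> carrier_mat n n"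
    and P: "permutation_matrix n P" and dims: "m + a + b + c = n"
    and U: "U \<in> carrier_mat m a" "zero_one_mat U" and V: "V \<in> carrier_mat b m" "zero_one_mat V"
    and VU: "zero_one_mat (V * U)"
    and eq: "P * A * transpose_mat P =
      msum n (\<lambda>i. \<mu> i \<cdot>\<^sub>m outer_prod (col (col_blocks m a c V) i) (row (row_blocks m b c U) i)) {..<m}"
  shows "hadamard_compatible n N (\<lambda>p q. A $$ (p, q))"
proof -
  obtain p where p: "p permutes {..<n}" and P: "P = mat n n (\<lambda>(i, j). if j = p i then 1 else 0)"
    using P by (auto simp: permutation_matrix_def)
  define C where "C = col_blocks m a c V"
  define R where "R = row_blocks m b c U"
  have CR: "C \<in> carrier_mat n m" "R \<in> carrier_mat m n"
    using row_blocks_carrier[OF U(1), of b c] col_blocks_carrier[OF V(1), of a c] dims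
    by (auto simp: C_def R_def)
  have C: "C $$ (i, j) = (if i < m then of_bool (i = j) else
      if m + a \<le> i \<and> i < m + a + b then V $$ (i - m - a, j) else 0)" if "i < n" "j < m" for i j
    using col_blocks_index[OF V(1), of i a c j] that dims by (simp add: C_def)
  have R: "R $$ (i, j) = (if j < m then of_bool (i = j) else if j < m + a then U $$ (i, j - m) else 0)"
    if "i < m" "j < n" for i j
    using row_blocks_index[OF U(1), of i j b c] that dims by (simp add: R_def)
  have C01: "C $$ (i, j) \<in> {0, 1}" if "i < n" "j < m" for i j
  proof -
    have "V $$ (i - m - a, j) = 0 \<or> V $$ (i - m - a, j) = 1" if "m + a \<le> i" "i < m + a + b"
      using that V zero_one_mat_iff[OF V(1)] \<open>j < m\<close> by simp
    thus ?thesis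
      using that by (auto simp: C)
  qed
  have R01: "R $$ (i, j) \<in> {0, 1}" if "i < m" "j < n" for i j
    using that U zero_one_mat_iff[OF U(1)] by (auto simp: R)
  have CR01: "(\<Sum>d<m. C $$ (i, d) * R $$ (d, j)) \<in> {0, 1}" if ij: "i < n" "j < n" for i j
  proof -
    \<comment> \<open>In the first two cases row \<open>i\<close> of \<open>C\<close> or column
      \<open>j\<close> of \<open>R\<close> is a unit vector; the third is the block
      \<open>V * U\<close>; otherwise one factor vanishes.\<close>
    consider "i < m" | "j < m" | "m + a \<le> i" "i < m + a + b" "m \<le> j" "j < m + a"
      | "\<And>d. d < m \<Longrightarrow> C $$ (i, d) * R $$ (d, j) = 0"
      using ij by (auto simp: C R) (meson not_le)
    thus ?thesis
    proof cases
      case 1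
      have "(\<Sum>d<m. C $$ (i, d) * R $$ (d, j)) = (\<Sum>d<m. if d = i then R $$ (i, j) else 0)"
        using 1 ij by (intro sum.cong) (auto simp: C)
      thus ?thesis using 1 ij R01 by simp
    next
      case 2
      have "(\<Sum>d<m. C $$ (i, d) * R $$ (d, j)) = (\<Sum>d<m. if d = j then C $$ (i, j) else 0)"
        using 2 ij by (intro sum.cong) (auto simp: R)
      thus ?thesis using 2 ij C01 by simp
    next
      case 3
      have "(\<Sum>d<m. C $$ (i, d) * R $$ (d, j)) = (V * U) $$ (i - m - a, j - m)"
        using 3 ij U V by (auto simp: C R scalar_prod_def atLeast0LessThan)
      thus ?thesis
        using VU U V 3 zero_one_mat_iff[of "V * U" b a] by auto
    next
      case 4
      thus ?thesis by (subst sum.neutral) auto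
    qed
  qed
  have "hadamard_compatible n N (\<lambda>i j. A $$ (p i, p j))"
  proof (rule orthogonal_decomposition_imp_hadamard_compatible[where I = "{..<m}" and l = \<mu>
        and e = "\<lambda>d i j. C $$ (i, d) * R $$ (d, j)"])
    fix i j assume ij: "i < n" "j < n"
    let ?O = "\<lambda>d. outer_prod (col C d) (row R d)"
    have O: "\<mu> d \<cdot>\<^sub>m ?O d \<in> carrier_mat n n" for d
      using CR outer_prod_carrier[of "col C d" "row R d"] by simp
    have "A $$ (p i, p j) = (P * A * transpose_mat P) $$ (i, j)"
      using permutation_conjugate_index(2)[OF p P A ij] by simp
    also have "\<dots> = (\<Sum>d<m. (\<mu> d \<cdot>\<^sub>m ?O d) $$ (i, j))"
      unfolding eq C_def[symmetric] R_def[symmetric] using ij by (intro msum_index(2) O) auto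
    also have "\<dots> = (\<Sum>d<m. \<mu> d * (C $$ (i, d) * R $$ (d, j)))"
    proof (intro sum.cong refl)
      fix d assume "d \<in> {..<m}"
      moreover have "?O d \<in> carrier_mat n n"
        using CR outer_prod_carrier[of "col C d" "row R d"] by simp
      ultimately show "(\<mu> d \<cdot>\<^sub>m ?O d) $$ (i, j) = \<mu> d * (C $$ (i, d) * R $$ (d, j))"
        using CR ij by (simp add: outer_prod_index)
    qed
    finally show "A $$ (p i, p j) = (\<Sum>d<m. \<mu> d * (C $$ (i, d) * R $$ (d, j)))" .
  next
    fix d i j assume "d \<in> {..<m}" "i < n" "j < n"
    thus "C $$ (i, d) * R $$ (d, j) \<in> {0, 1}"
      using C01[of i d] R01[of d j] by auto
  next
    fix d d' i j assume "d \<in> {..<m}" "d' \<in> {..<m}" "d \<noteq> d'" "i < n" "j < n"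
    thus "C $$ (i, d) * R $$ (d, j) = 0 \<or> C $$ (i, d') * R $$ (d', j) = 0"
      using C01[of i] R01[of _ j] CR01[of i j] dims n
      by (intro at_most_one_if_sum_zero_one[OF char, of m]) fastforce+
  next
    fix d d' i j assume d: "d \<in> {..<m}" "d' \<in> {..<m}" and ij: "i < n" "j < n"
    have "(\<Sum>t<n. C $$ (i, d) * R $$ (d, t) * (C $$ (t, d') * R $$ (d', j))) =
        C $$ (i, d) * R $$ (d', j) * (\<Sum>t<n. R $$ (d, t) * C $$ (t, d'))"
      unfolding sum_distrib_left by (intro sum.cong) (auto simp: algebra_simps)
    \<comment> \<open>This is \<open>R * C\<close>: past the identity blocks, \<open>U\<close> meets
      zeros of \<open>C\<close> and \<open>V\<close> meets zeros of \<open>R\<close>.\<close>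
    also have "(\<Sum>t<n. R $$ (d, t) * C $$ (t, d')) = (\<Sum>t<n. if t = d then of_bool (d = d') else 0)"
      using d by (intro sum.cong) (auto simp: C R)
    also have "\<dots> = of_bool (d = d')"
      using d dims by auto
    finally show "(\<Sum>t<n. C $$ (i, d) * R $$ (d, t) * (C $$ (t, d') * R $$ (d', j))) =
        (if d = d' then C $$ (i, d) * R $$ (d, j) else 0)" by simp
  qed simp
  from hadamard_compatible_permutes[OF p this] show ?thesis .
qed

section \<open>Rank and block form from unique midpoints\<close>

text \<open>The permutation reads off the concatenated listings of \<open>D\<close>,
  \<open>K\<close>, \<open>W\<close> and the remaining indices \<open>Z\<close>.\<close>

lemma ex_permutation_blocks:
  fixes D K W :: "nat set"
  assumes sub: "D \<subseteq> {..<n}" "K \<subseteq> {..<n}" "W \<subseteq> {..<n}"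
    and disj: "D \<inter> K = {}" "D \<inter> W = {}" "K \<inter> W = {}"
  obtains p where "p permutes {..<n}" "card D + card K + card W \<le> n"
    "\<And>i. i < n \<Longrightarrow> p i \<in> D \<longleftrightarrow> i < card D"
    "\<And>i. i < n \<Longrightarrow> p i \<in> K \<longleftrightarrow> card D \<le> i \<and> i < card D + card K"
    "\<And>i. i < n \<Longrightarrow> p i \<in> W \<longleftrightarrow> card D + card K \<le> i \<and> i < card D + card K + card W"
proof -
  have fin: "finite D" "finite K" "finite W" by (rule finite_subset[OF _ finite_lessThan], fact sub)+
  define Z where "Z = {..<n} - (D \<union> K \<union> W)"
  define xs where "xs = sorted_list_of_set D @ sorted_list_of_set K @ sorted_list_of_set W @ sorted_list_of_set Z"
  have finZ: "finite Z" by (simp add: Z_def)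
  have set: "set xs = {..<n}" using sub fin finZ by (auto simp: xs_def Z_def)
  have dist: "distinct xs" using disj fin finZ by (auto simp: xs_def Z_def)
  have len: "length xs = n" using distinct_card[OF dist] set by simp
  define p where "p i = (if i < n then xs ! i else i)" for i
  have "bij_betw ((!) xs) {..<n} {..<n}"
    by (rule bij_betw_nth[OF dist]) (simp_all add: len set)
  hence "bij_betw p {..<n} {..<n}"
    by (subst bij_betw_cong[where g = "(!) xs"]) (simp_all add: p_def)
  hence p: "p permutes {..<n}"
    by (rule bij_imp_permutes) (simp add: p_def)
  have len': "n = card D + card K + card W + card Z"
    using len by (simp add: xs_def)
  have D: "p i \<in> D" if "i < card D" for i
    using that len' fin nth_mem[of i "sorted_list_of_set D"]
    by (simp add: p_def xs_def nth_append)
  have K: "p i \<in> K" if "card D \<le> i" "i < card D + card K" for i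
  proof -
    have "i < n" "\<not> i < card D" "i - card D < card K"
      using that len' by linarith+
    thus ?thesis
      using that fin nth_mem[of "i - card D" "sorted_list_of_set K"]
      by (simp add: p_def xs_def nth_append)
  qed
  have W: "p i \<in> W" if "card D + card K \<le> i" "i < card D + card K + card W" for i
  proof -
    have "i < n" "\<not> i < card D" "\<not> i - card D < card K" "i - card D - card K < card W"
      using that len' by linarith+
    thus ?thesis
      using that fin nth_mem[of "i - card D - card K" "sorted_list_of_set W"]
      by (simp add: p_def xs_def nth_append)
  qed
  have Z: "p i \<in> Z" if "card D + card K + card W \<le> i" "i < n" for i
  proof -
    have "\<not> i < card D" "\<not> i - card D < card K" "\<not> i - card D - card K < card W" "i - card D - card K - card W < card Z"
      using that len' by linarith+
    thus ?thesis
      using that finZ nth_mem[of "i - card D - card K - card W" "sorted_list_of_set Z"]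
      by (simp add: p_def xs_def nth_append)
  qed
  have ZD: "Z \<inter> (D \<union> K \<union> W) = {}" by (auto simp: Z_def)
  \<comment> \<open>Each position lies in one of four intervals, whose images are pairwise disjoint;
    this supplies the converse implications.\<close>
  have "(p i \<in> D \<longleftrightarrow> i < card D) \<and> (p i \<in> K \<longleftrightarrow> card D \<le> i \<and> i < card D + card K) \<and>
     (p i \<in> W \<longleftrightarrow> card D + card K \<le> i \<and> i < card D + card K + card W)" if "i < n" for i
  proof -
    consider "i < card D" | "card D \<le> i" "i < card D + card K"
      | "card D + card K \<le> i" "i < card D + card K + card W" | "card D + card K + card W \<le> i"
      by linarith
    thus ?thesis
    proof cases
      case 1
      with D[OF this] disj show ?thesis by auto
    next
      case 2
      with K[OF this] disj show ?thesis by auto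
    next
      case 3
      with W[OF this] disj show ?thesis by auto
    next
      case 4
      with Z[OF this that] ZD show ?thesis by auto
    qed
  qed
  thus ?thesis
    using p len' by (intro that[of p]) auto
qed

text \<open>The columns at loops form a diagonal block on the loops, and column \<open>q\<close> is
  the sum of the columns of those loops \<open>d\<close> with an arc to \<open>q\<close>.\<close>

lemma unique_midpoints_imp_rank:
  fixes A :: "'a :: field mat"
  assumes A: "A \<in> carrier_mat n n" and um: "unique_midpoints n (\<lambda>p q. A $$ (p, q))"
  shows "vec_space.rank n A = card {d. d < n \<and> A $$ (d, d) \<noteq> 0}"
proof -
  interpret unique_midpoints n "\<lambda>p q. A $$ (p, q)" by (fact um)
  have "vec_space.rank n A = card loops"
  proof (rule vec_space.rank_eq_card_if_diagonal[OF A loops_subset loops_subset loops_discrete])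
    fix q assume q: "q < n"
    have "A $$ (p, q) = (\<Sum>d\<in>loops. of_bool (A $$ (d, q) \<noteq> 0) * A $$ (p, d))" if p: "p < n" for p
      unfolding entry_eq_sum_loops[OF p q]
    proof (intro sum.cong refl)
      fix d assume d: "d \<in> loops"
      have "A $$ (p, d) \<noteq> 0 \<Longrightarrow> A $$ (d, d) = A $$ (p, d)"
        using mid_eq[of p d d] d p by (auto simp: loops_def)
      thus "A $$ (d, d) * (of_bool (A $$ (p, d) \<noteq> 0) * of_bool (A $$ (d, q) \<noteq> 0)) =
          of_bool (A $$ (d, q) \<noteq> 0) * A $$ (p, d)"
        by (cases "A $$ (p, d) = 0") simp_all
    qed
    thus "\<exists>x. \<forall>p<n. A $$ (p, q) = (\<Sum>d\<in>loops. x d * A $$ (p, d))"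
      by (intro exI[of _ "\<lambda>d. of_bool (A $$ (d, q) \<noteq> 0)"]) simp
  qed
  thus ?thesis by (simp add: loops_def)
qed

text \<open>With \<open>f\<close> the zero-one pattern of \<open>A\<close>, the block column and the
  block row are the columns and rows of \<open>f\<close> at the loops, after reordering. Their
  product is \<open>f\<close> again, which makes \<open>V * U\<close> a zero-one matrix.\<close>

lemma unique_midpoints_imp_block_form:
  fixes A :: "'a :: field mat"
  assumes A: "A \<in> carrier_mat n n" and um: "unique_midpoints n (\<lambda>p q. A $$ (p, q))"
    and m: "m = card {d. d < n \<and> A $$ (d, d) \<noteq> 0}"
  shows "\<exists>(P::'a mat) (\<mu>::nat \<Rightarrow> 'a) (a::nat) (b::nat) (c::nat) (U::'a mat) (V::'a mat).
           permutation_matrix n P \<and> (\<forall>i<m. \<mu> i \<noteq> 0) \<and> m + a + b + c = n \<and>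
           U \<in> carrier_mat m a \<and> zero_one_mat U \<and>
           V \<in> carrier_mat b m \<and> zero_one_mat V \<and>
           (\<forall>j<a. col U j \<noteq> 0\<^sub>v m) \<and> (\<forall>i<b. row V i \<noteq> 0\<^sub>v m) \<and>
           zero_one_mat (V * U) \<and>
           P * A * transpose_mat P =
             msum n (\<lambda>i. \<mu> i \<cdot>\<^sub>m outer_prod (col (col_blocks m a c V) i) (row (row_blocks m b c U) i)) {..<m}"
proof -
  interpret unique_midpoints n "\<lambda>p q. A $$ (p, q)" by (fact um)
  define f :: "nat \<Rightarrow> nat \<Rightarrow> 'a" where "f p q = of_bool (A $$ (p, q) \<noteq> 0)" for p q
  \<comment> \<open>A vertex with arcs in both directions is a loop, so these sets are disjoint.
    Vertices outside loops, sinks and sources are isolated and fill the last block, of size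
    \<open>c\<close>.\<close>
  define sinks where "sinks = {q. q < n \<and> q \<notin> loops \<and> (\<exists>p<n. A $$ (p, q) \<noteq> 0)}"
  define sources where "sources = {p. p < n \<and> p \<notin> loops \<and> (\<exists>q<n. A $$ (p, q) \<noteq> 0)}"
  define a where "a = card sinks"
  define b where "b = card sources"
  have m: "m = card loops" using m by (simp add: loops_def)
  have not_both: "x \<in> loops" if "p < n" "q < n" "x < n" "A $$ (p, x) \<noteq> 0" "A $$ (x, q) \<noteq> 0" for p q x
    using mid_in_loops(1)[OF that] .
  have sub: "sinks \<subseteq> {..<n}" "sources \<subseteq> {..<n}"
    by (auto simp: sinks_def sources_def)
  have "sinks \<inter> sources = {}"
    using not_both by (fastforce simp: sinks_def sources_def)
  moreover have "loops \<inter> sinks = {}" "loops \<inter> sources = {}"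
    by (auto simp: sinks_def sources_def)
  ultimately obtain p where p: "p permutes {..<n}" and le: "card loops + card sinks + card sources \<le> n"
    and p_loops: "\<And>i. i < n \<Longrightarrow> p i \<in> loops \<longleftrightarrow> i < card loops"
    and p_sinks: "\<And>i. i < n \<Longrightarrow> p i \<in> sinks \<longleftrightarrow> card loops \<le> i \<and> i < card loops + card sinks"
    and p_sources: "\<And>i. i < n \<Longrightarrow> p i \<in> sources \<longleftrightarrow>
      card loops + card sinks \<le> i \<and> i < card loops + card sinks + card sources"
    using ex_permutation_blocks[OF loops_subset sub] by metis
  define c where "c = n - m - a - b"
  have dims: "m + a + b + c = n"
    using le by (simp add: m a_def b_def c_def)
  note p_loops = p_loops[folded m a_def b_def]
    and p_sinks = p_sinks[folded m a_def b_def] and p_sources = p_sources[folded m a_def b_def]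
  have p_lt: "p i < n" if "i < n" for i
    using permutes_in_image[OF p, of i] that by auto
  have bij: "bij_betw p {..<m} loops"
  proof (rule bij_betw_imageI)
    show "inj_on p {..<m}"
      using permutes_inj_on[OF p] .
    show "p ` {..<m} = loops"
    proof
      show "p ` {..<m} \<subseteq> loops" using p_loops dims by auto
      show "loops \<subseteq> p ` {..<m}"
      proof
        fix d assume d: "d \<in> loops"
        hence "d \<in> p ` {..<n}" using permutes_image[OF p] by (auto simp: loops_def)
        thus "d \<in> p ` {..<m}" using p_loops d by auto
      qed
    qed
  qed
  have sum_f: "(\<Sum>d<m. f (p i) (p d) * f (p d) (p j)) = f (p i) (p j)" if "i < n" "j < n" for i j
  proof -
    have "(\<Sum>d<m. f (p i) (p d) * f (p d) (p j)) = (\<Sum>d\<in>loops. f (p i) d * f d (p j))"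
      by (rule sum.reindex_bij_betw[OF bij])
    also have "\<dots> = (\<Sum>d\<in>loops. 1 * (f (p i) d * f d (p j)))" by simp
    also have "\<dots> = 1 * f (p i) (p j)"
      unfolding f_def using that p_lt by (intro sum_over_loops) auto
    finally show ?thesis by simp
  qed
  \<comment> \<open>\<open>U\<close> records the arcs from loops to sinks, \<open>V\<close> those
    from sources to loops.\<close>
  define U where "U = mat m a (\<lambda>(i, j). f (p i) (p (m + j)))"
  define V where "V = mat b m (\<lambda>(i, j). f (p (m + a + i)) (p j))"
  define P :: "'a mat" where "P = mat n n (\<lambda>(i, j). if j = p i then 1 else 0)"
  define \<mu> where "\<mu> i = A $$ (p i, p i)" for i
  have U: "U \<in> carrier_mat m a" and V: "V \<in> carrier_mat b m"
    by (simp_all add: U_def V_def)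
  define C where "C = col_blocks m a c V"
  define R where "R = row_blocks m b c U"
  have CR: "C \<in> carrier_mat n m" "R \<in> carrier_mat m n"
    using row_blocks_carrier[OF U, of b c] col_blocks_carrier[OF V, of a c] dims
    by (auto simp: C_def R_def)
  have f_loops: "f (p i) (p j) = of_bool (i = j)" if "i < m" "j < m" for i j
  proof -
    have "p i \<in> loops" "p j \<in> loops" using that p_loops dims by auto
    moreover have "p i = p j \<longleftrightarrow> i = j" using permutes_inj[OF p] by (auto simp: inj_def)
    ultimately show ?thesis using loops_discrete by (simp add: f_def)
  qed
  \<comment> \<open>The zero blocks are correct because a vertex that is neither a loop nor a source
    has no outgoing arc. Dually, \<open>R\<close> relies on the absence of incoming arcs.\<close>
  have C: "C $$ (i, d) = f (p i) (p d)" if "i < n" "d < m" for i d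
  proof -
    have "f (p i) (p d) = 0" if "\<not> i < m" "\<not> (m + a \<le> i \<and> i < m + a + b)"
      using p_loops[OF \<open>i < n\<close>] p_sources[OF \<open>i < n\<close>] that p_lt[OF \<open>i < n\<close>] p_lt[of d] \<open>d < m\<close> dims
      by (auto simp: sources_def f_def)
    thus ?thesis
      using col_blocks_index[OF V, of i a c d] that dims f_loops by (auto simp: C_def V_def)
  qed
  have R: "R $$ (d, j) = f (p d) (p j)" if "j < n" "d < m" for j d
  proof -
    have "f (p d) (p j) = 0" if "\<not> j < m" "\<not> j < m + a"
      using p_loops[OF \<open>j < n\<close>] p_sinks[OF \<open>j < n\<close>] that p_lt[OF \<open>j < n\<close>] p_lt[of d] \<open>d < m\<close> dims
      by (auto simp: sinks_def f_def)
    thus ?thesis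
      using row_blocks_index[OF U, of d j b c] that dims f_loops by (auto simp: R_def U_def)
  qed
  have "permutation_matrix n P"
    using p by (auto simp: permutation_matrix_def P_def)
  moreover have "\<forall>i<m. \<mu> i \<noteq> 0"
  proof (intro allI impI)
    fix i assume "i < m"
    with p_loops[of i] dims show "\<mu> i \<noteq> 0"
      by (simp add: \<mu>_def loops_def)
  qed
  moreover have "zero_one_mat U" "zero_one_mat V"
    unfolding zero_one_mat_iff[OF U] zero_one_mat_iff[OF V] by (simp_all add: U_def V_def f_def)
  moreover have "zero_one_mat (V * U)"
  proof -
    have "(V * U) $$ (i, j) = f (p (m + a + i)) (p (m + j))" if "i < b" "j < a" for i j
    proof -
      have "(V * U) $$ (i, j) = (\<Sum>d<m. f (p (m + a + i)) (p d) * f (p d) (p (m + j)))"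
        using that by (simp add: U_def V_def scalar_prod_def atLeast0LessThan)
      thus ?thesis
        using that dims sum_f by simp
    qed
    thus ?thesis
      using U V by (subst zero_one_mat_iff[of _ b a]) (auto simp: f_def)
  qed
  \<comment> \<open>A sink has an incoming arc, whose midpoint is a loop with an arc to the sink: a
    one in this column. Dually for the sources and the rows of \<open>V\<close>.\<close>
  moreover have "\<forall>j<a. col U j \<noteq> 0\<^sub>v m"
  proof (intro allI impI notI)
    fix j assume j: "j < a" and "col U j = 0\<^sub>v m"
    hence 0: "f (p i) (p (m + j)) = 0" if "i < m" for i
      using that U by (auto simp: vec_eq_iff) (auto simp: U_def)
    have "p (m + j) \<in> sinks" using p_sinks[of "m + j"] j dims by auto
    then obtain x where x: "x < n" "p (m + j) < n" "A $$ (x, p (m + j)) \<noteq> 0"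
      by (auto simp: sinks_def)
    then obtain t where t: "t < n" "A $$ (x, t) \<noteq> 0" "A $$ (t, p (m + j)) \<noteq> 0"
      using mid_ex by blast
    hence "t \<in> loops" using mid_in_loops(1)[OF x(1,2) t] by simp
    then obtain i where "i < m" "t = p i"
      using bij_betw_imp_surj_on[OF bij] by blast
    thus False using 0[of i] t by (simp add: f_def)
  qed
  moreover have "\<forall>i<b. row V i \<noteq> 0\<^sub>v m"
  proof (intro allI impI notI)
    fix i assume i: "i < b" and "row V i = 0\<^sub>v m"
    hence 0: "f (p (m + a + i)) (p j) = 0" if "j < m" for j
      using that V by (auto simp: vec_eq_iff) (auto simp: V_def)
    have "p (m + a + i) \<in> sources" using p_sources[of "m + a + i"] i dims by auto
    then obtain y where y: "p (m + a + i) < n" "y < n" "A $$ (p (m + a + i), y) \<noteq> 0"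
      by (auto simp: sources_def)
    then obtain t where t: "t < n" "A $$ (p (m + a + i), t) \<noteq> 0" "A $$ (t, y) \<noteq> 0"
      using mid_ex by blast
    hence "t \<in> loops" using mid_in_loops(1)[OF y(1,2) t] by simp
    then obtain j where "j < m" "t = p j"
      using bij_betw_imp_surj_on[OF bij] by blast
    thus False using 0[of j] t by (simp add: f_def)
  qed
  moreover have "P * A * transpose_mat P =
      msum n (\<lambda>i. \<mu> i \<cdot>\<^sub>m outer_prod (col C i) (row R i)) {..<m}" (is "?L = ?M")
  proof (rule eq_matI)
    have O: "outer_prod (col C d) (row R d) \<in> carrier_mat n n" for d
      using CR outer_prod_carrier[of "col C d" "row R d"] by simp
    have L: "?L \<in> carrier_mat n n"
      by (rule permutation_conjugate_index(1)[OF p P_def A])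
    have M: "?M \<in> carrier_mat n n"
      using O by (intro msum_index(1)) auto
    show "dim_row ?L = dim_row ?M" "dim_col ?L = dim_col ?M" using L M by auto
    fix i j assume "i < dim_row ?M" "j < dim_col ?M"
    hence ij: "i < n" "j < n" using M by auto
    have "?M $$ (i, j) = (\<Sum>d<m. (\<mu> d \<cdot>\<^sub>m outer_prod (col C d) (row R d)) $$ (i, j))"
      using ij O by (intro msum_index(2)) auto
    also have "\<dots> = (\<Sum>d<m. \<mu> d * (f (p i) (p d) * f (p d) (p j)))"
    proof (intro sum.cong refl)
      fix d assume "d \<in> {..<m}"
      thus "(\<mu> d \<cdot>\<^sub>m outer_prod (col C d) (row R d)) $$ (i, j) = \<mu> d * (f (p i) (p d) * f (p d) (p j))"
        using CR ij O[of d] C R by (simp add: outer_prod_index)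
    qed
    also have "\<dots> = (\<Sum>d\<in>loops. A $$ (d, d) * (f (p i) d * f d (p j)))"
      unfolding \<mu>_def by (rule sum.reindex_bij_betw[OF bij])
    also have "\<dots> = A $$ (p i, p j)"
      unfolding f_def using entry_eq_sum_loops p_lt ij by simp
    finally show "?L $$ (i, j) = ?M $$ (i, j)"
      using permutation_conjugate_index(2)[OF p P_def A ij] by simp
  qed
  ultimately show ?thesis
    using dims U V unfolding C_def R_def by blast
qed

section \<open>Equivalence of the four conditions\<close>

theorem theorem3:
  fixes A :: "'a :: field mat" and n m :: nat
  assumes n_pos: "n > 0"
    and char: "CHAR('a) = 0 \<or> CHAR('a) > n"
    and A: "A \<in> carrier_mat n n"
    and A_nonzero: "A \<noteq> 0\<^sub>m n n"
    and rank: "vec_space.rank n A = m"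
  defines "cond_a \<equiv> \<forall>r::nat. r > 0 \<longrightarrow> A ^\<^sub>m r = hadamard_pow A r"
    and "cond_b \<equiv> \<forall>r\<in>{2..n + 1}. A ^\<^sub>m r = hadamard_pow A r"
    and "cond_c \<equiv> \<exists>(k::nat) (l::nat \<Rightarrow> 'a) (E::nat \<Rightarrow> 'a mat).
           k > 0 \<and> inj_on l {..<k} \<and>
           (\<forall>i<k. l i \<noteq> 0 \<and> E i \<in> carrier_mat n n \<and> idempotent_mat (E i) \<and> zero_one_mat (E i)) \<and>
           A = msum n (\<lambda>i. l i \<cdot>\<^sub>m E i) {..<k} \<and>
           (\<forall>i<k. \<forall>j<k. i \<noteq> j \<longrightarrow> E i \<circ>\<^sub>H E j = 0\<^sub>m n n \<and> E i * E j = 0\<^sub>m n n)"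
    and "cond_d \<equiv> \<exists>(P::'a mat) (\<mu>::nat \<Rightarrow> 'a) (a::nat) (b::nat) (c::nat) (U::'a mat) (V::'a mat).
           permutation_matrix n P \<and> (\<forall>i<m. \<mu> i \<noteq> 0) \<and> m + a + b + c = n \<and>
           U \<in> carrier_mat m a \<and> zero_one_mat U \<and>
           V \<in> carrier_mat b m \<and> zero_one_mat V \<and>
           (\<forall>j<a. col U j \<noteq> 0\<^sub>v m) \<and> (\<forall>i<b. row V i \<noteq> 0\<^sub>v m) \<and>
           zero_one_mat (V * U) \<and>
           P * A * transpose_mat P =
             msum n (\<lambda>i. \<mu> i \<cdot>\<^sub>m outer_prod (col (col_blocks m a c V) i) (row (row_blocks m b c U) i)) {..<m}"
  shows "(cond_a \<longleftrightarrow> cond_b) \<and> (cond_a \<longleftrightarrow> cond_c) \<and> (cond_a \<longleftrightarrow> cond_d)"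
proof -
  \<comment> \<open>Exponent 1 is immediate; any \<open>r \<ge> 2\<close> lies in
    \<open>{2..r + 1}\<close>, so the bound \<open>N = r\<close> settles it.\<close>
  have a_if: cond_a if H: "\<And>N. hadamard_compatible n N (\<lambda>p q. A $$ (p, q))"
    unfolding cond_a_def
  proof (intro allI impI)
    fix r :: nat assume "r > 0"
    show "A ^\<^sub>m r = hadamard_pow A r"
    proof (cases "r = 1")
      case True
      thus ?thesis using A by (auto simp: hadamard_pow_def intro!: eq_matI)
    next
      case False
      have "\<forall>r\<in>{2..r + 1}. A ^\<^sub>m r = hadamard_pow A r"
        using H pow_mat_eq_hadamard_pow_iff[OF A, of r] by blast
      thus ?thesis using False \<open>r > 0\<close> by simp
    qed
  qed
  have ab: "cond_a \<Longrightarrow> cond_b"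
    by (simp add: cond_a_def cond_b_def)
  have levels: "orthogonal_levels n (\<lambda>p q. A $$ (p, q))" if cond_b
    using that hadamard_compatible_imp_orthogonal_levels pow_mat_eq_hadamard_pow_iff[OF A, of n]
    unfolding cond_b_def by blast
  have bc: "cond_b \<Longrightarrow> cond_c"
    unfolding cond_c_def by (rule orthogonal_levels_imp_spectral_decomposition[OF A A_nonzero levels])
  have bd: cond_d if cond_b
  proof -
    have um: "unique_midpoints n (\<lambda>p q. A $$ (p, q))"
      by (rule orthogonal_levels_imp_unique_midpoints[OF levels[OF that] char n_pos])
    \<comment> \<open>The prescribed rank is the number of loops, which is the size of the identity
      blocks.\<close>
    have "m = card {d. d < n \<and> A $$ (d, d) \<noteq> 0}"
      using unique_midpoints_imp_rank[OF A um] rank by simp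
    thus ?thesis
      unfolding cond_d_def by (rule unique_midpoints_imp_block_form[OF A um])
  qed
  have ca: cond_a if cond_c
  proof (rule a_if)
    fix N
    from that obtain k :: nat and l and E :: "nat \<Rightarrow> 'a mat" where
      "\<forall>i<k. l i \<noteq> 0 \<and> E i \<in> carrier_mat n n \<and> idempotent_mat (E i) \<and> zero_one_mat (E i)"
      "A = msum n (\<lambda>i. l i \<cdot>\<^sub>m E i) {..<k}"
      "\<forall>i<k. \<forall>j<k. i \<noteq> j \<longrightarrow> E i \<circ>\<^sub>H E j = 0\<^sub>m n n \<and> E i * E j = 0\<^sub>m n n"
      unfolding cond_c_def by blast
    thus "hadamard_compatible n N (\<lambda>p q. A $$ (p, q))"
      by (intro spectral_decomposition_imp_hadamard_compatible[of k E n A l]) auto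
  qed
  have da: cond_a if cond_d
  proof (rule a_if)
    fix N
    from that obtain P :: "'a mat" and \<mu> a b c and U V :: "'a mat" where
      "permutation_matrix n P" "m + a + b + c = n" "U \<in> carrier_mat m a" "zero_one_mat U"
      "V \<in> carrier_mat b m" "zero_one_mat V" "zero_one_mat (V * U)"
      "P * A * transpose_mat P =
        msum n (\<lambda>i. \<mu> i \<cdot>\<^sub>m outer_prod (col (col_blocks m a c V) i) (row (row_blocks m b c U) i)) {..<m}"
      unfolding cond_d_def by blast
    thus "hadamard_compatible n N (\<lambda>p q. A $$ (p, q))"
      by (rule block_form_imp_hadamard_compatible[OF char n_pos A])
  qed
  show ?thesis
    using ab bc bd ca da by blast
qed

end
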